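(* Let $\mathscr{S}=(\mathscr{P},\mathscr{L},\mathscr{I})$ be a projective plane and let $\mathbf{P}\subseteq\mathscr{P}$ be a finite set of points. Then one of the following statements holds: (1) $|\mathbf{P}_3|\geq \frac14 |\mathbf{P}|^2$; (2) $\mathbf{P}_1$ is equal to the set of points of a projective subplane of $\mathscr{S}$, or to the set of points of a projective subplane of $\mathscr{S}$ minus one point; (3) $\mathbf{P}$ is a degenerate subplane of $\mathscr{S}$.
   Context: An incidence system is a triple $(\mathscr{P},\mathscr{L},\mathscr{I})$ of a set of points $\mathscr{P}$, a set of lines $\mathscr{L}$ and a relation $\mathscr{I}\subseteq\mathscr{P}\times\mathscr{L}$ (incidence). A projective plane (not assumed finite, Desarguesian or Pappian) is an incidence system satisfying: (P1) any two distinct points are incident with exactly one common line; (P2) any two distinct lines are incident with exactly one common point; (P3) there exist four points, no three of which are incident with the same line. A degenerate projective plane is an incidence system satisfying (P1) and (P2) but not (P3). Given a set of points $\mathbf{P}$ of a projective plane, define $\mathbf{P}_0=\mathbf{P}$; for $i\ge 0$, $\mathbf{L}_i$ is the set of lines of $\mathscr{L}$ incident with at least two points of $\mathbf{P}_i$; for $i\ge 1$, $\mathbf{P}_i$ is the set of points of $\mathscr{P}$ incident with at least two lines of $\mathbf{L}_{i-1}$. A set $Q\subseteq\mathscr{P}$ is the set of points of a projective subplane of $\mathscr{S}$ if there is a set of lines $\mathscr{L}'\subseteq\mathscr{L}$ such that $Q$, $\mathscr{L}'$ and the restriction of $\mathscr{I}$ to $Q\times\mathscr{L}'$ form a projective plane.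 A set $Q\subseteq\mathscr{P}$ is a degenerate subplane if there is $\mathscr{L}'\subseteq\mathscr{L}$ such that $Q$, $\mathscr{L}'$ and the restriction of $\mathscr{I}$ to $Q\times \mathscr{L}'$ form a degenerate projective plane; this means that either all points of $Q$ lie on a common line of $\mathscr{L}$, or $Q$ is the point set of a fan, i.e. there is a line of $\mathscr{L}$ incident with all points of $Q$ except exactly one. *)

theory Defs
  imports Complex_Main
begin

definition incidence_system :: "'p set \<Rightarrow> 'l set \<Rightarrow> ('p \<times> 'l) set \<Rightarrow> bool" where
  "incidence_system \<P> \<L> \<I> \<longleftrightarrow> \<I> \<subseteq> \<P> \<times> \<L>"

definition axiom_P1 :: "'p set \<Rightarrow> 'l set \<Rightarrow> ('p \<times> 'l) set \<Rightarrow> bool" where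
  "axiom_P1 \<P> \<L> \<I> \<longleftrightarrow>
     (\<forall>p\<in>\<P>. \<forall>q\<in>\<P>. p \<noteq> q \<longrightarrow> (\<exists>!l. l \<in> \<L> \<and> (p, l) \<in> \<I> \<and> (q, l) \<in> \<I>))"

definition axiom_P2 :: "'p set \<Rightarrow> 'l set \<Rightarrow> ('p \<times> 'l) set \<Rightarrow> bool" where
  "axiom_P2 \<P> \<L> \<I> \<longleftrightarrow>
     (\<forall>l\<in>\<L>. \<forall>m\<in>\<L>. l \<noteq> m \<longrightarrow> (\<exists>!p. p \<in> \<P> \<and> (p, l) \<in> \<I> \<and> (p, m) \<in> \<I>))"

definition axiom_P3 :: "'p set \<Rightarrow> 'l set \<Rightarrow> ('p \<times> 'l) set \<Rightarrow> bool" where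
  "axiom_P3 \<P> \<L> \<I> \<longleftrightarrow>
     (\<exists>A\<subseteq>\<P>. card A = 4 \<and>
        (\<forall>B\<subseteq>A. card B = 3 \<longrightarrow> \<not> (\<exists>l\<in>\<L>. \<forall>p\<in>B. (p, l) \<in> \<I>)))"

definition projective_plane :: "'p set \<Rightarrow> 'l set \<Rightarrow> ('p \<times> 'l) set \<Rightarrow> bool" where
  "projective_plane \<P> \<L> \<I> \<longleftrightarrow>
     incidence_system \<P> \<L> \<I> \<and> axiom_P1 \<P> \<L> \<I> \<and> axiom_P2 \<P> \<L> \<I> \<and> axiom_P3 \<P> \<L> \<I>"

definition degenerate_projective_plane :: "'p set \<Rightarrow> 'l set \<Rightarrow> ('p \<times> 'l) set \<Rightarrow> bool" where
  "degenerate_projective_plane \<P> \<L> \<I> \<longleftrightarrow>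
     incidence_system \<P> \<L> \<I> \<and> axiom_P1 \<P> \<L> \<I> \<and> axiom_P2 \<P> \<L> \<I> \<and> \<not> axiom_P3 \<P> \<L> \<I>"

definition subplane_points :: "'p set \<Rightarrow> 'l set \<Rightarrow> ('p \<times> 'l) set \<Rightarrow> 'p set \<Rightarrow> bool" where
  "subplane_points \<P> \<L> \<I> Q \<longleftrightarrow>
     Q \<subseteq> \<P> \<and> (\<exists>\<L>'\<subseteq>\<L>. projective_plane Q \<L>' (\<I> \<inter> Q \<times> \<L>'))"

definition degenerate_subplane :: "'p set \<Rightarrow> 'l set \<Rightarrow> ('p \<times> 'l) set \<Rightarrow> 'p set \<Rightarrow> bool" where
  "degenerate_subplane \<P> \<L> \<I> Q \<longleftrightarrow>
     Q \<subseteq> \<P> \<and> (\<exists>\<L>'\<subseteq>\<L>. degenerate_projective_plane Q \<L>' (\<I> \<inter> Q \<times> \<L>'))"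

definition joining_lines :: "'l set \<Rightarrow> ('p \<times> 'l) set \<Rightarrow> 'p set \<Rightarrow> 'l set" where
  "joining_lines \<L> \<I> Q =
     {l \<in> \<L>. \<exists>p\<in>Q. \<exists>q\<in>Q. p \<noteq> q \<and> (p, l) \<in> \<I> \<and> (q, l) \<in> \<I>}"

definition meeting_points :: "'p set \<Rightarrow> ('p \<times> 'l) set \<Rightarrow> 'l set \<Rightarrow> 'p set" where
  "meeting_points \<P> \<I> M =
     {p \<in> \<P>. \<exists>l\<in>M. \<exists>m\<in>M. l \<noteq> m \<and> (p, l) \<in> \<I> \<and> (p, m) \<in> \<I>}"

text \<open>The points \<open>\<^bold>P\<^sub>i\<close> obtained from \<open>\<^bold>P\<close> after \<open>i\<close> rounds of joining and intersecting;
  the lines \<open>\<^bold>L\<^sub>i\<close> are the joining lines of \<open>\<^bold>P\<^sub>i\<close>. A round need not be extensive: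
  if \<open>\<^bold>P\<close> is collinear, then \<open>\<^bold>P\<^sub>1\<close> is empty.\<close>

primrec gen_points :: "'p set \<Rightarrow> 'l set \<Rightarrow> ('p \<times> 'l) set \<Rightarrow> 'p set \<Rightarrow> nat \<Rightarrow> 'p set" where
  "gen_points \<P> \<L> \<I> P 0 = P"
| "gen_points \<P> \<L> \<I> P (Suc i) =
     meeting_points \<P> \<I> (joining_lines \<L> \<I> (gen_points \<P> \<L> \<I> P i))"

end

theory Submission
  imports Defs
begin

text \<open>
  If \<open>P\<close> is not degenerate, every line misses at least two of its points, and the sets
  \<open>P\<^sub>i\<close> increase. If some line carries more than half of \<open>P\<close>, the lines joining its points to two
  points off it already meet in at least \<open>|P|\<^sup>2 / 4\<close> points of \<open>P\<^sub>1\<close>. Otherwise consider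
  \<open>P\<^sub>2 - P\<^sub>1\<close>. A point \<open>x\<close> of this set lies on at most one line of \<open>L\<^sub>0\<close>, so joining \<open>x\<close> to
  the points of \<open>P\<close> yields at least \<open>|P| / 2 + 1\<close> lines of \<open>L\<^sub>2\<close>; two such points give
  \<open>|P|\<^sup>2 / 4\<close> intersections in \<open>P\<^sub>3\<close>. If the set is empty, \<open>P\<^sub>1\<close> is closed under joining and
  meeting, and if it is a singleton, then \<open>P\<^sub>2\<close> is.
\<close>

section \<open>Joining and meeting in a projective plane\<close>

locale plane =
  fixes \<P> :: "'p set" and \<L> :: "'l set" and \<I> :: "('p \<times> 'l) set"
  assumes plane: "projective_plane \<P> \<L> \<I>"
begin

text \<open>Choice makes \<open>join\<close> and \<open>meet\<close> total functions. Their values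
  are determined only for distinct points or lines of the plane, so the facts about them carry a
  disequality.\<close>

definition join :: "'p \<Rightarrow> 'p \<Rightarrow> 'l" where
  "join p q = (SOME l. (p, l) \<in> \<I> \<and> (q, l) \<in> \<I>)"

definition meet :: "'l \<Rightarrow> 'l \<Rightarrow> 'p" where
  "meet l m = (SOME p. (p, l) \<in> \<I> \<and> (p, m) \<in> \<I>)"

abbreviation J :: "'p set \<Rightarrow> 'l set" where
  "J \<equiv> joining_lines \<L> \<I>"

abbreviation M :: "'l set \<Rightarrow> 'p set" where
  "M \<equiv> meeting_points \<P> \<I>"

text \<open>A line missing at most one point of \<open>Q\<close> makes \<open>Q\<close> collinear or
  a fan; asking for two missed points excludes exactly these sets. In this form the property passes
  to larger point sets.\<close>

definition nondegenerate :: "'p set \<Rightarrow> bool" where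
  "nondegenerate Q \<longleftrightarrow> Q \<subseteq> \<P> \<and>
     (\<forall>l\<in>\<L>. \<exists>p\<in>Q. \<exists>q\<in>Q. p \<noteq> q \<and> (p, l) \<notin> \<I> \<and> (q, l) \<notin> \<I>)"

text \<open>Noncollinearity already forces three points of the plane to be distinct: a repetition
  would leave at most two points, and these share a line.\<close>

definition triangle :: "'p \<Rightarrow> 'p \<Rightarrow> 'p \<Rightarrow> bool" where
  "triangle a b c \<longleftrightarrow> (\<forall>l. \<not> ((a, l) \<in> \<I> \<and> (b, l) \<in> \<I> \<and> (c, l) \<in> \<I>))"

lemma incD: "(p, l) \<in> \<I> \<Longrightarrow> p \<in> \<P> \<and> l \<in> \<L>"
  using plane by (auto simp: projective_plane_def incidence_system_def)

lemma line_unique: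
  assumes "p \<noteq> q" "(p, l) \<in> \<I>" "(q, l) \<in> \<I>" "(p, m) \<in> \<I>" "(q, m) \<in> \<I>"
  shows "l = m"
proof -
  have "\<exists>!l. l \<in> \<L> \<and> (p, l) \<in> \<I> \<and> (q, l) \<in> \<I>"
    using plane assms incD unfolding projective_plane_def axiom_P1_def by blast
  then show ?thesis using assms incD by blast
qed

lemma point_unique:
  assumes "l \<noteq> m" "(p, l) \<in> \<I>" "(p, m) \<in> \<I>" "(q, l) \<in> \<I>" "(q, m) \<in> \<I>"
  shows "p = q"
  using line_unique assms by blast

lemma join_inc:
  assumes "p \<in> \<P>" "q \<in> \<P>" "p \<noteq> q"
  shows "(p, join p q) \<in> \<I>" "(q, join p q) \<in> \<I>"
proof -
  have "\<exists>l. (p, l) \<in> \<I> \<and> (q, l) \<in> \<I>"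
    using plane assms unfolding projective_plane_def axiom_P1_def by blast
  from someI_ex[OF this] show "(p, join p q) \<in> \<I>" "(q, join p q) \<in> \<I>"
    by (auto simp: join_def)
qed

lemma join_eq:
  assumes "p \<noteq> q" "(p, l) \<in> \<I>" "(q, l) \<in> \<I>"
  shows "join p q = l"
  using assms join_inc line_unique incD by metis

lemma meet_inc:
  assumes "l \<in> \<L>" "m \<in> \<L>" "l \<noteq> m"
  shows "(meet l m, l) \<in> \<I>" "(meet l m, m) \<in> \<I>"
proof -
  have "\<exists>p. (p, l) \<in> \<I> \<and> (p, m) \<in> \<I>"
    using plane assms unfolding projective_plane_def axiom_P2_def by blast
  from someI_ex[OF this] show "(meet l m, l) \<in> \<I>" "(meet l m, m) \<in> \<I>"
    by (auto simp: meet_def)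
qed

lemma meet_eq:
  assumes "l \<noteq> m" "(p, l) \<in> \<I>" "(p, m) \<in> \<I>"
  shows "meet l m = p"
  using assms meet_inc point_unique incD by metis

text \<open>(P1) yields lines only through two distinct points; the four points of (P3) ensure that
  there is a second one.\<close>

lemma line_through:
  assumes "p \<in> \<P>"
  obtains l where "(p, l) \<in> \<I>"
proof -
  obtain A where "A \<subseteq> \<P>" "card A = 4"
    using plane unfolding projective_plane_def axiom_P3_def by blast
  moreover have "\<not> A \<subseteq> {p}"
    using \<open>card A = 4\<close> card_mono[of "{p}" A] by auto
  ultimately obtain q where "q \<in> \<P>" "q \<noteq> p" by blast
  then show ?thesis using that join_inc(1) assms by blast
qed

lemma JI: "p \<in> Q \<Longrightarrow> q \<in> Q \<Longrightarrow> p \<noteq> q \<Longrightarrow> (p, l) \<in> \<I> \<Longrightarrow> (q, l) \<in> \<I> \<Longrightarrow> l \<in> J Q"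
  using incD by (auto simp: joining_lines_def)

lemma J_lines: "J Q \<subseteq> \<L>"
  by (auto simp: joining_lines_def)

lemma MI: "l \<in> N \<Longrightarrow> m \<in> N \<Longrightarrow> l \<noteq> m \<Longrightarrow> (p, l) \<in> \<I> \<Longrightarrow> (p, m) \<in> \<I> \<Longrightarrow> p \<in> M N"
  using incD by (auto simp: meeting_points_def)

lemma M_points: "M N \<subseteq> \<P>"
  by (auto simp: meeting_points_def)

lemma join_in_J: "p \<in> Q \<Longrightarrow> q \<in> Q \<Longrightarrow> Q \<subseteq> \<P> \<Longrightarrow> p \<noteq> q \<Longrightarrow> join p q \<in> J Q"
  using JI[of p Q q "join p q"] join_inc[of p q] by blast

lemma finite_J:
  assumes "finite Q"
  shows "finite (J Q)"
proof (rule finite_subset)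
  show "J Q \<subseteq> (\<lambda>(p, q). join p q) ` (Q \<times> Q)"
  proof
    fix l assume "l \<in> J Q"
    then obtain p q where "p \<in> Q" "q \<in> Q" "l = join p q"
      unfolding joining_lines_def using join_eq by blast
    then show "l \<in> (\<lambda>(p, q). join p q) ` (Q \<times> Q)" by auto
  qed
qed (use assms in simp)

lemma finite_M:
  assumes "finite N"
  shows "finite (M N)"
proof (rule finite_subset)
  show "M N \<subseteq> (\<lambda>(l, m). meet l m) ` (N \<times> N)"
  proof
    fix p assume "p \<in> M N"
    then obtain l m where "l \<in> N" "m \<in> N" "p = meet l m"
      unfolding meeting_points_def using meet_eq by blast
    then show "p \<in> (\<lambda>(l, m). meet l m) ` (N \<times> N)" by auto
  qed
qed (use assms in simp)

section \<open>Nondegenerate point sets\<close>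

text \<open>Each \<open>q\<close> in \<open>Q\<close> lies on two lines of \<open>J Q\<close>: one
  joins it to a point \<open>a\<close> off some line through \<open>q\<close>, the other to a point
  \<open>b\<close> off \<open>join q a\<close>.\<close>

lemma M_J_extensive:
  assumes "nondegenerate Q"
  shows "Q \<subseteq> M (J Q)"
proof
  fix q assume q: "q \<in> Q"
  have Q: "Q \<subseteq> \<P>" using assms by (simp add: nondegenerate_def)
  obtain l where l: "(q, l) \<in> \<I>" using q Q line_through by blast
  then obtain a where a: "a \<in> Q" "(a, l) \<notin> \<I>"
    using assms incD unfolding nondegenerate_def by blast
  then have qa: "q \<noteq> a" using l by blast
  have aj: "(q, join q a) \<in> \<I>" "(a, join q a) \<in> \<I>" using q a Q qa join_inc by blast+
  then obtain b where b: "b \<in> Q" "(b, join q a) \<notin> \<I>"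
    using assms incD unfolding nondegenerate_def by blast
  then have qb: "q \<noteq> b" using aj by blast
  have bj: "(q, join q b) \<in> \<I>" "(b, join q b) \<in> \<I>" using q b Q qb join_inc by blast+
  have "join q a \<in> J Q" "join q b \<in> J Q" using q a b Q qa qb join_in_J by auto
  then show "q \<in> M (J Q)" using MI aj bj b by metis
qed

lemma nondegenerate_M_J:
  assumes "nondegenerate Q"
  shows "nondegenerate (M (J Q))"
  using M_J_extensive[OF assms] assms M_points unfolding nondegenerate_def by (meson subset_iff)

lemma triangleI:
  assumes "p \<noteq> q" "(p, l) \<in> \<I>" "(q, l) \<in> \<I>" "(r, l) \<notin> \<I>"
  shows "triangle p q r" "triangle p r q" "triangle r p q"
  using assms line_unique unfolding triangle_def by blast+

text \<open>Points \<open>a\<close>, \<open>b\<close> on \<open>l\<close> and points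
  \<open>c\<close>, \<open>d\<close> off \<open>l\<close> on a line \<open>m\<close> form a
  quadrangle unless \<open>m\<close> passes through \<open>a\<close> or \<open>b\<close>. It cannot
  contain both, and then a further point \<open>e\<close> off \<open>m\<close> replaces one of the
  four.\<close>

lemma exists_quadrangle:
  assumes "nondegenerate Q"
  obtains a b c d where "{a, b, c, d} \<subseteq> Q"
    "triangle a b c" "triangle a b d" "triangle a c d" "triangle b c d"
proof -
  let ?quad = "\<lambda>a b c d. {a, b, c, d} \<subseteq> Q \<and>
    triangle a b c \<and> triangle a b d \<and> triangle a c d \<and> triangle b c d"
  have Q: "Q \<subseteq> \<P>" and off: "\<And>l. l \<in> \<L> \<Longrightarrow> \<exists>p\<in>Q. \<exists>q\<in>Q. p \<noteq> q \<and> (p, l) \<notin> \<I> \<and> (q, l) \<notin> \<I>"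
    using assms by (auto simp: nondegenerate_def)
  obtain l0 where "l0 \<in> \<L>" using incD plane line_through
    unfolding projective_plane_def axiom_P3_def by (metis card.empty equals0I numeral_eq_iff subset_iff zero_neq_numeral)
  from off[OF this] obtain a b where ab: "a \<in> Q" "b \<in> Q" "a \<noteq> b" by blast
  obtain l where l: "(a, l) \<in> \<I>" "(b, l) \<in> \<I>" using ab Q join_inc by blast
  from off[of l] obtain c d where cd: "c \<in> Q" "d \<in> Q" "c \<noteq> d" "(c, l) \<notin> \<I>" "(d, l) \<notin> \<I>"
    using l incD by blast
  obtain m where m: "(c, m) \<in> \<I>" "(d, m) \<in> \<I>" using cd Q join_inc by blast
  have meets: "\<exists>a b c d. ?quad a b c d"
    if a: "a \<in> Q" "b \<in> Q" "a \<noteq> b" "(a, l) \<in> \<I>" "(b, l) \<in> \<I>" "(a, m) \<in> \<I>" for a b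
  proof -
    have bm: "(b, m) \<notin> \<I>" using a cd m line_unique by blast
    \<comment> \<open>Of the two points off \<open>m\<close>, at least one differs from
      \<open>b\<close>.\<close>
    from off[of m] obtain e where e: "e \<in> Q" "e \<noteq> b" "(e, m) \<notin> \<I>"
      using m incD by metis
    show ?thesis
    proof (cases "(e, l) \<in> \<I>")
      case True
      have "?quad b e c d"
        using triangleI[of b e l] triangleI[of c d m] True a cd m bm e by blast
      then show ?thesis by blast
    next
      case False
      obtain k where k: "(b, k) \<in> \<I>" "(e, k) \<in> \<I>" using a e Q join_inc by blast
      have be: "b \<noteq> e" and ac: "a \<noteq> c" "a \<noteq> d" using e cd a by blast+
      \<comment> \<open>The line \<open>k\<close> through \<open>b\<close> and \<open>e\<close>
        cannot contain both \<open>c\<close> and \<open>d\<close>, for it would be \<open>m\<close>,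
        which misses \<open>b\<close>. If it contains one of them, that point is dropped and
        \<open>a\<close> is kept.\<close>
      consider "(c, k) \<notin> \<I>" "(d, k) \<notin> \<I>" | "(d, k) \<notin> \<I>" | "(c, k) \<notin> \<I>"
        using k bm line_unique cd m by blast
      then show ?thesis
      proof cases
        case 1
        then have "?quad b e c d" using triangleI[of b e k] triangleI[of c d m] k m bm e cd a by blast
        then show ?thesis by blast
      next
        case 2
        then have "triangle b e d" using triangleI(1)[OF be k] by blast
        moreover have "triangle a e d" using triangleI(2)[OF ac(2) a(6) m(2) e(3)] .
        ultimately have "?quad a b e d"
          using triangleI(1)[OF a(3,4,5)] False cd a(1,2) e(1) by blast
        then show ?thesis by blast
      next
        case 3
        then have "triangle b e c" using triangleI(1)[OF be k] by blast
        moreover have "triangle a e c" using triangleI(2)[OF ac(1) a(6) m(1) e(3)] .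
        ultimately have "?quad a b e c"
          using triangleI(1)[OF a(3,4,5)] False cd a(1,2) e(1) by blast
        then show ?thesis by blast
      qed
    qed
  qed
  consider "(a, m) \<in> \<I>" | "(b, m) \<in> \<I>" | "(a, m) \<notin> \<I>" "(b, m) \<notin> \<I>" by blast
  then have "\<exists>a b c d. ?quad a b c d"
  proof cases
    case 1 then show ?thesis using meets[of a b] ab l by blast
  next
    case 2 then show ?thesis using meets[of b a] ab l by blast
  next
    case 3
    then have "?quad a b c d" using triangleI[of a b l] triangleI[of c d m] ab l cd m by blast
    then show ?thesis by blast
  qed
  then obtain a b c d where "?quad a b c d" by blast
  then show ?thesis by (intro that[of a b c d]) blast+
qed

section \<open>Subplanes and degenerate subplanes\<close>

text \<open>\<open>J Q\<close> serves as the set of lines: it contains all joins, closure puts all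
  meets into \<open>Q\<close>, and a quadrangle in \<open>Q\<close> provides (P3).\<close>

lemma subplane_pointsI:
  assumes nd: "nondegenerate Q" and closed: "M (J Q) \<subseteq> Q"
  shows "subplane_points \<P> \<L> \<I> Q"
proof -
  have Q: "Q \<subseteq> \<P>" using nd by (simp add: nondegenerate_def)
  let ?I = "\<I> \<inter> Q \<times> J Q"
  have "axiom_P1 Q (J Q) ?I"
    unfolding axiom_P1_def
  proof (intro ballI impI)
    fix p q assume pq: "p \<in> Q" "q \<in> Q" "p \<noteq> q"
    show "\<exists>!l. l \<in> J Q \<and> (p, l) \<in> ?I \<and> (q, l) \<in> ?I"
    proof (rule ex1I[of _ "join p q"])
      show "join p q \<in> J Q \<and> (p, join p q) \<in> ?I \<and> (q, join p q) \<in> ?I"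
        using pq Q join_in_J[of p Q q] join_inc[of p q] by blast
    qed (use pq join_eq in blast)
  qed
  moreover have "axiom_P2 Q (J Q) ?I"
    unfolding axiom_P2_def
  proof (intro ballI impI)
    fix l m assume lm: "l \<in> J Q" "m \<in> J Q" "l \<noteq> m"
    then have inc: "(meet l m, l) \<in> \<I>" "(meet l m, m) \<in> \<I>"
      using meet_inc J_lines by blast+
    then have "meet l m \<in> Q" using lm MI closed by blast
    then show "\<exists>!p. p \<in> Q \<and> (p, l) \<in> ?I \<and> (p, m) \<in> ?I"
      using inc lm point_unique by (intro ex1I[of _ "meet l m"]) blast+
  qed
  moreover have "axiom_P3 Q (J Q) ?I"
  proof -
    obtain a b c d where A: "{a, b, c, d} \<subseteq> Q"
      and t: "triangle a b c" "triangle a b d" "triangle a c d" "triangle b c d"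
      using exists_quadrangle[OF nd] by metis
    have two: "\<exists>l. (p, l) \<in> \<I> \<and> (q, l) \<in> \<I>" if "p \<in> Q" "q \<in> Q" for p q
    proof (cases "p = q")
      case True
      then show ?thesis using that Q line_through[of p] by (metis subsetD)
    next
      case False
      then show ?thesis using that Q join_inc[of p q] by blast
    qed
    have "a \<noteq> b" "a \<noteq> c" "a \<noteq> d" "b \<noteq> c" "b \<noteq> d" "c \<noteq> d"
      using A t two[of a b] two[of a c] unfolding triangle_def by blast+
    then have dist: "distinct [a, b, c, d]" by simp
    \<comment> \<open>A three-element subset omits exactly one of the four points, so it is one of
      the triangles in \<open>t\<close>.\<close>
    have no3: "\<not> (\<exists>l\<in>J Q. \<forall>p\<in>B. (p, l) \<in> ?I)" if B: "B \<subseteq> {a, b, c, d}" "card B = 3" for B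
    proof
      assume "\<exists>l\<in>J Q. \<forall>p\<in>B. (p, l) \<in> ?I"
      then obtain l where l: "\<And>p. p \<in> B \<Longrightarrow> (p, l) \<in> \<I>" by blast
      have "card ({a, b, c, d} - B) = 1"
        using dist B card_Diff_subset[of B "{a, b, c, d}"] finite_subset[OF B(1)] by simp
      then obtain x where x: "{a, b, c, d} - B = {x}" by (auto simp: card_1_singleton_iff)
      then have inB: "y \<in> B" if "y \<in> {a, b, c, d}" "y \<noteq> x" for y using that by blast
      from x consider "x = a" | "x = b" | "x = c" | "x = d" by blast
      then show False
        using t l[OF inB, of a] l[OF inB, of b] l[OF inB, of c] l[OF inB, of d] dist
        unfolding triangle_def by cases auto
    qed
    show ?thesis unfolding axiom_P3_def
      by (rule exI[of _ "{a, b, c, d}"]) (use A dist no3 in simp)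
  qed
  ultimately have "projective_plane Q (J Q) ?I"
    by (auto simp: projective_plane_def incidence_system_def)
  then show ?thesis using Q J_lines unfolding subplane_points_def by blast
qed

text \<open>The point \<open>x\<close> may lie on \<open>l\<close> or outside \<open>Q\<close>, so
  that collinear sets and fans are treated together. The lines are \<open>l\<close> alone if it
  carries all of \<open>Q\<close>, and otherwise \<open>l\<close> with the lines joining
  \<open>x\<close> to the other points.\<close>

lemma degenerate_subplaneI:
  assumes Q: "Q \<subseteq> \<P>" and l: "l \<in> \<L>" and fan: "\<And>q. q \<in> Q \<Longrightarrow> q \<noteq> x \<Longrightarrow> (q, l) \<in> \<I>"
  shows "degenerate_subplane \<P> \<L> \<I> Q"
proof -
  \<comment> \<open>Among four points at least three differ from \<open>x\<close>, and these lie on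
    \<open>l\<close>.\<close>
  have noP3: "\<not> axiom_P3 Q L' (\<I> \<inter> Q \<times> L')" if "l \<in> L'" for L'
  proof
    assume "axiom_P3 Q L' (\<I> \<inter> Q \<times> L')"
    then obtain A where A: "A \<subseteq> Q" "card A = 4"
      and no3: "\<And>B. B \<subseteq> A \<Longrightarrow> card B = 3 \<Longrightarrow> \<not> (\<exists>l\<in>L'. \<forall>p\<in>B. (p, l) \<in> \<I> \<inter> Q \<times> L')"
      unfolding axiom_P3_def by metis
    have "3 \<le> card (A - {x})" using A(2) by (simp add: card_Diff_singleton_if)
    then obtain B where B: "B \<subseteq> A - {x}" "card B = 3" by (meson obtain_subset_with_card_n)
    then have "\<forall>p\<in>B. (p, l) \<in> \<I> \<inter> Q \<times> L'" using fan A that by blast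
    then show False using no3 B that by blast
  qed
  show ?thesis
  proof (cases "\<forall>q\<in>Q. (q, l) \<in> \<I>")
    case True
    then have "axiom_P1 Q {l} (\<I> \<inter> Q \<times> {l})" "axiom_P2 Q {l} (\<I> \<inter> Q \<times> {l})"
      by (auto simp: axiom_P1_def axiom_P2_def)
    then have "degenerate_projective_plane Q {l} (\<I> \<inter> Q \<times> {l})"
      using noP3[of "{l}"] by (auto simp: degenerate_projective_plane_def incidence_system_def)
    then show ?thesis using Q l unfolding degenerate_subplane_def by blast
  next
    case False
    then have x: "x \<in> Q" "(x, l) \<notin> \<I>" using fan by blast+
    let ?L = "insert l (join x ` (Q - {x}))"
    let ?I = "\<I> \<inter> Q \<times> ?L"
    have j: "(x, join x q) \<in> \<I>" "(q, join x q) \<in> \<I>" if "q \<in> Q - {x}" for q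
      using that x Q join_inc[of x q] by blast+
    have L: "?L \<subseteq> \<L>" using l j incD by blast
    have thr: "m = l \<or> (x, m) \<in> \<I>" if "m \<in> ?L" for m using that j by blast
    have "axiom_P1 Q ?L ?I"
      unfolding axiom_P1_def
    proof (intro ballI impI)
      fix p q assume pq: "p \<in> Q" "q \<in> Q" "p \<noteq> q"
      have "\<exists>m\<in>?L. (p, m) \<in> \<I> \<and> (q, m) \<in> \<I>"
      proof (cases "p = x \<or> q = x")
        case True then show ?thesis using j[of p] j[of q] pq by blast
      next
        case False then show ?thesis using fan pq by blast
      qed
      then obtain m where "m \<in> ?L" "(p, m) \<in> \<I>" "(q, m) \<in> \<I>" by blast
      then show "\<exists>!m. m \<in> ?L \<and> (p, m) \<in> ?I \<and> (q, m) \<in> ?I"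
        using pq line_unique by (intro ex1I[of _ m]) blast+
    qed
    moreover have "axiom_P2 Q ?L ?I"
      unfolding axiom_P2_def
    proof (intro ballI impI)
      fix m k assume mk: "m \<in> ?L" "k \<in> ?L" "m \<noteq> k"
      \<comment> \<open>A line \<open>join x q\<close> meets \<open>l\<close> in \<open>q\<close>,
        and two lines other than \<open>l\<close> meet in \<open>x\<close>.\<close>
      have "\<exists>p\<in>Q. (p, m) \<in> \<I> \<and> (p, k) \<in> \<I>"
      proof (cases "m = l \<or> k = l")
        case True
        then show ?thesis using mk j fan by blast
      next
        case False then show ?thesis using thr mk x by blast
      qed
      then obtain p where "p \<in> Q" "(p, m) \<in> \<I>" "(p, k) \<in> \<I>" by blast
      then show "\<exists>!p. p \<in> Q \<and> (p, m) \<in> ?I \<and> (p, k) \<in> ?I"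
        using mk point_unique by (intro ex1I[of _ p]) blast+
    qed
    ultimately have "degenerate_projective_plane Q ?L ?I"
      using noP3[of ?L] by (auto simp: degenerate_projective_plane_def incidence_system_def)
    then show ?thesis using Q L unfolding degenerate_subplane_def by blast
  qed
qed

lemma nondegenerateI:
  assumes "Q \<subseteq> \<P>" "\<not> degenerate_subplane \<P> \<L> \<I> Q"
  shows "nondegenerate Q"
  using assms degenerate_subplaneI unfolding nondegenerate_def by metis

section \<open>Closure after one new point\<close>

text \<open>Projection from \<open>p\<close> sends a point of \<open>m\<close> to its join with
  \<open>p\<close>; the inverse sends \<open>l\<close> to \<open>meet l m\<close>. This meet lies in
  \<open>M (J Q)\<close>, hence in \<open>Q\<close> unless it is \<open>x\<close>, and the condition
  on \<open>x\<close> removes exactly the lines meeting \<open>m\<close> in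
  \<open>x\<close>.\<close>

lemma card_line_eq_card_pencil:
  assumes Q: "Q \<subseteq> \<P>" "x \<notin> Q" "M (J Q) \<subseteq> insert x Q"
    and p: "p \<in> Q" "(p, m) \<notin> \<I>" and m: "m \<in> J Q"
  shows "card {q \<in> Q. (q, m) \<in> \<I>}
    = card {l \<in> J Q. (p, l) \<in> \<I> \<and> \<not> ((x, l) \<in> \<I> \<and> (x, m) \<in> \<I>)}"
proof (rule bij_betw_same_card[of "join p"], rule bij_betw_byWitness[where f' = "\<lambda>l. meet l m"])
  have j: "(p, join p q) \<in> \<I>" "(q, join p q) \<in> \<I>" "join p q \<noteq> m" "join p q \<in> J Q"
    if "q \<in> Q" "(q, m) \<in> \<I>" for q
    using that p Q join_inc[of p q] join_in_J[of p Q q] by (metis subsetD)+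
  have mt: "(meet l m, l) \<in> \<I>" "(meet l m, m) \<in> \<I>" "l \<noteq> m" "p \<noteq> meet l m"
    if "l \<in> J Q" "(p, l) \<in> \<I>" for l
    using that p m meet_inc[of l m] J_lines by (metis subsetD)+
  show "join p ` {q \<in> Q. (q, m) \<in> \<I>} \<subseteq>
      {l \<in> J Q. (p, l) \<in> \<I> \<and> \<not> ((x, l) \<in> \<I> \<and> (x, m) \<in> \<I>)}"
    using j point_unique Q(2) by blast
  show "(\<lambda>l. meet l m) ` {l \<in> J Q. (p, l) \<in> \<I> \<and> \<not> ((x, l) \<in> \<I> \<and> (x, m) \<in> \<I>)} \<subseteq>
      {q \<in> Q. (q, m) \<in> \<I>}"
  proof (rule image_subsetI)
    fix l assume l: "l \<in> {l \<in> J Q. (p, l) \<in> \<I> \<and> \<not> ((x, l) \<in> \<I> \<and> (x, m) \<in> \<I>)}"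
    then have "meet l m \<in> M (J Q)" using mt m by (intro MI[of l _ m]) auto
    moreover have "meet l m \<noteq> x" using l mt by auto
    ultimately show "meet l m \<in> {q \<in> Q. (q, m) \<in> \<I>}" using l mt Q by auto
  qed
  show "\<forall>q\<in>{q \<in> Q. (q, m) \<in> \<I>}. meet (join p q) m = q"
    using j meet_eq by auto
  show "\<forall>l\<in>{l \<in> J Q. (p, l) \<in> \<I> \<and> \<not> ((x, l) \<in> \<I> \<and> (x, m) \<in> \<I>)}. join p (meet l m) = l"
    using mt join_eq by auto
qed

text \<open>Suppose a new line joins \<open>x\<close> to \<open>p \<in> Q\<close>, and let \<open>s, t \<in> J Q\<close> be two lines through \<open>x\<close>. Then a line
  \<open>m \<in> J Q\<close> avoiding \<open>x\<close>, \<open>p\<close> and a point \<open>b\<close> of \<open>s\<close> has, counted from \<open>p\<close>, as many points of \<open>Q\<close> as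
  \<open>t\<close>, but, counted from \<open>b\<close>, one more, because the line \<open>s\<close> through \<open>b\<close> meets \<open>t\<close> in \<open>x \<notin> Q\<close>.\<close>

lemma closed_insert:
  assumes Q: "Q \<subseteq> \<P>" "finite Q" "x \<notin> Q" and MJ: "M (J Q) = insert x Q"
  shows "M (J (insert x Q)) = insert x Q"
proof -
  have "J (insert x Q) \<subseteq> J Q"
  proof (rule ccontr)
    assume "\<not> J (insert x Q) \<subseteq> J Q"
    then obtain l where l: "l \<in> J (insert x Q)" "l \<notin> J Q" by blast
    then obtain p where p: "p \<in> Q" "(p, l) \<in> \<I>" "(x, l) \<in> \<I>"
      unfolding joining_lines_def by blast
    \<comment> \<open>The line \<open>l\<close> is the only one through \<open>p\<close> and
      \<open>x\<close>, and it is not in \<open>J Q\<close>. Hence no line is removed when counting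
      at \<open>p\<close>.\<close>
    have px: "\<not> (x, k) \<in> \<I>" if "k \<in> J Q" "(p, k) \<in> \<I>" for k
      using that p l Q line_unique[of p x k l] by blast
    have "x \<in> M (J Q)" using MJ by blast
    then obtain s t where st: "s \<in> J Q" "t \<in> J Q" "s \<noteq> t" "(x, s) \<in> \<I>" "(x, t) \<in> \<I>"
      unfolding meeting_points_def by blast
    obtain a b where ab: "a \<in> Q" "b \<in> Q" "a \<noteq> b" "(a, s) \<in> \<I>" "(b, s) \<in> \<I>"
      using st(1) unfolding joining_lines_def by blast
    obtain c d where cd: "c \<in> Q" "d \<in> Q" "c \<noteq> d" "(c, t) \<in> \<I>" "(d, t) \<in> \<I>"
      using st(2) unfolding joining_lines_def by blast
    have pst: "(p, s) \<notin> \<I>" "(p, t) \<notin> \<I>" using px st by blast+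
    have off: "(b, t) \<notin> \<I>" "(a, t) \<notin> \<I>" using st ab Q(3) point_unique[of s t] by blast+
    \<comment> \<open>If \<open>p\<close> were on the joins of \<open>a\<close> with both
      \<open>c\<close> and \<open>d\<close>, these would coincide, being lines through
      \<open>a\<close> and \<open>p\<close>, and would equal \<open>t\<close>, which misses
      \<open>p\<close>.\<close>
    have "\<exists>e\<in>Q. (e, t) \<in> \<I> \<and> (p, join a e) \<notin> \<I>"
    proof (rule ccontr)
      assume "\<not> ?thesis"
      then have "(p, join a c) \<in> \<I>" "(p, join a d) \<in> \<I>" using cd by blast+
      moreover have "(a, join a c) \<in> \<I>" "(c, join a c) \<in> \<I>" "(a, join a d) \<in> \<I>" "(d, join a d) \<in> \<I>"
        using ab cd off Q join_inc by blast+
      ultimately show False using ab cd pst off line_unique by metis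
    qed
    then obtain e where e: "e \<in> Q" "(e, t) \<in> \<I>" "(p, join a e) \<notin> \<I>" by blast
    define m where "m = join a e"
    have ae: "a \<noteq> e" using e off by blast
    have m: "(a, m) \<in> \<I>" "(e, m) \<in> \<I>" "m \<in> J Q"
      using ab e ae Q join_inc[of a e] join_in_J[of a Q e] unfolding m_def by blast+
    have es: "(e, s) \<notin> \<I>" using e st Q(3) point_unique[of s t e x] by blast
    have bm: "(b, m) \<notin> \<I>" using m ab es line_unique[of a b m s] by blast
    have xm: "(x, m) \<notin> \<I>" using m ab es st Q(3) line_unique[of x a m s] by blast
    have sub: "M (J Q) \<subseteq> insert x Q" using MJ by blast
    note cnt = card_line_eq_card_pencil[OF Q(1) Q(3) sub]
    let ?N = "\<lambda>p. {l \<in> J Q. (p, l) \<in> \<I>}"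
    have "card {q \<in> Q. (q, m) \<in> \<I>} = card (?N p)"
      using cnt[OF p(1) _ m(3)] e(3) xm unfolding m_def by simp
    moreover have "card {q \<in> Q. (q, t) \<in> \<I>} = card (?N p)"
      unfolding cnt[OF p(1) pst(2) st(2)] using px by (intro arg_cong[where f = card]) blast
    moreover have "card {q \<in> Q. (q, m) \<in> \<I>} = card (?N b)"
      using cnt[OF ab(2) bm m(3)] xm by simp
    moreover have "card {q \<in> Q. (q, t) \<in> \<I>} = card (?N b - {s})"
    proof -
      have "{l \<in> J Q. (b, l) \<in> \<I> \<and> \<not> ((x, l) \<in> \<I> \<and> (x, t) \<in> \<I>)} = ?N b - {s}"
        using st ab Q(3) line_unique[of b x _ s] by blast
      then show ?thesis using cnt[OF ab(2) off(1) st(2)] by simp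
    qed
    moreover have "card (?N b - {s}) < card (?N b)"
      using st ab Q by (intro card_Diff1_less) (auto simp: finite_J)
    ultimately show False by simp
  qed
  moreover have "J Q \<subseteq> J (insert x Q)" by (auto simp: joining_lines_def)
  ultimately show ?thesis using MJ by auto
qed

section \<open>Intersections of two pencils\<close>

text \<open>The point \<open>meet a b\<close> determines \<open>a\<close> as its line to
  \<open>x\<close> and \<open>b\<close> as its line to \<open>y\<close>, so distinct pairs give
  distinct points. Restricting the count to points off \<open>l\<close> allows points on
  \<open>l\<close> to be added to it.\<close>

lemma card_pencils_le_meeting_points:
  assumes N: "N \<subseteq> \<L>" "finite N" and xy: "x \<noteq> y" "(x, l) \<in> \<I>" "(y, l) \<in> \<I>"
  shows "card {a \<in> N. (x, a) \<in> \<I> \<and> (y, a) \<notin> \<I>} * card {b \<in> N. (y, b) \<in> \<I> \<and> (x, b) \<notin> \<I>}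
    \<le> card {z \<in> M N. (z, l) \<notin> \<I>}" (is "card ?A * card ?B \<le> card ?Z")
proof -
  have mt: "(meet a b, a) \<in> \<I>" "(meet a b, b) \<in> \<I>" "a \<noteq> b" if "a \<in> ?A" "b \<in> ?B" for a b
    using that N meet_inc[of a b] by blast+
  have off: "(meet a b, l) \<notin> \<I>" if "a \<in> ?A" "b \<in> ?B" for a b
    using mt[OF that] that xy line_unique[of x "meet a b" a l] line_unique[of y "meet a b" b l] by blast
  have "inj_on (\<lambda>(a, b). meet a b) (?A \<times> ?B)"
  proof (rule inj_onI, clarify)
    fix a b a' b' assume *: "a \<in> N" "(x, a) \<in> \<I>" "(y, a) \<notin> \<I>" "b \<in> N" "(y, b) \<in> \<I>" "(x, b) \<notin> \<I>"
      "a' \<in> N" "(x, a') \<in> \<I>" "(y, a') \<notin> \<I>" "b' \<in> N" "(y, b') \<in> \<I>" "(x, b') \<notin> \<I>"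
      and eq: "meet a b = meet a' b'"
    then show "a = a' \<and> b = b'"
      using mt[of a b] mt[of a' b'] line_unique[of x "meet a b" a a'] line_unique[of y "meet a b" b b']
      by (metis (mono_tags, lifting) mem_Collect_eq)
  qed
  moreover have "(\<lambda>(a, b). meet a b) ` (?A \<times> ?B) \<subseteq> ?Z"
  proof clarify
    fix a b assume "a \<in> N" "(x, a) \<in> \<I>" "(y, a) \<notin> \<I>" "b \<in> N" "(y, b) \<in> \<I>" "(x, b) \<notin> \<I>"
    then have "a \<in> ?A" "b \<in> ?B" by auto
    then show "meet a b \<in> M N \<and> (meet a b, l) \<notin> \<I>" using mt off by (blast intro: MI)
  qed
  moreover have "finite ?Z" using N finite_M by simp
  ultimately have "card (?A \<times> ?B) \<le> card ?Z" by (rule card_inj_on_le)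
  then show ?thesis by (simp add: card_cartesian_product)
qed

text \<open>Two points of \<open>P\<close> with the same join to \<open>x\<close> span a line of
  \<open>J P\<close>, and at most one such line passes through \<open>x\<close>. Lines through
  \<open>y\<close> are excluded because the pencils at two new points must not share a line.\<close>

lemma card_pencil_new_point:
  assumes nd: "nondegenerate P" and fin: "finite P"
    and light: "\<And>l. l \<in> \<L> \<Longrightarrow> 2 * card {p \<in> P. (p, l) \<in> \<I>} \<le> card P"
    and x: "x \<in> R" "x \<notin> M (J P)" and R: "P \<subseteq> R" "R \<subseteq> \<P>" "finite R" and y: "y \<in> \<P>" "y \<noteq> x"
  shows "card P \<le> 2 * card {l \<in> J R. (x, l) \<in> \<I> \<and> (y, l) \<notin> \<I>}"
proof -
  let ?K = "{l \<in> J R. (x, l) \<in> \<I>}"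
  have finK: "finite ?K" using R finite_J by simp
  have xP: "x \<notin> P" using M_J_extensive[OF nd] x by blast
  have j: "(x, join x p) \<in> \<I>" "(p, join x p) \<in> \<I>" "join x p \<in> ?K" if "p \<in> P" for p
    using that xP x R join_inc[of x p] join_in_J[of x R p] by blast+
  have inj: "join x p \<in> J P" if "p \<in> P" "q \<in> P" "p \<noteq> q" "join x p = join x q" for p q
    using that JI[of p P q "join x p"] j[of p] j[of q] by simp
  \<comment> \<open>The surplus \<open>2\<close> stands for one extra line, which compensates for
    the later removal of \<open>join x y\<close>.\<close>
  have "card P + 2 \<le> 2 * card ?K"
  proof (cases "\<exists>s\<in>J P. (x, s) \<in> \<I>")
    case True
    then obtain s where s: "s \<in> J P" "(x, s) \<in> \<I>" by blast
    let ?S = "{p \<in> P. (p, s) \<in> \<I>}"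
    have only: "t = s" if "t \<in> J P" "(x, t) \<in> \<I>" for t using that s x MI by blast
    have "inj_on (join x) (P - ?S)"
      using inj only j by (intro inj_onI) (metis (no_types, lifting) DiffE mem_Collect_eq)
    moreover have "join x ` (P - ?S) \<subseteq> ?K - {s}" using j by blast
    ultimately have "card (P - ?S) \<le> card (?K - {s})" using finK by (intro card_inj_on_le) auto
    moreover have "card (P - ?S) = card P - card ?S" using fin by (intro card_Diff_subset) auto
    moreover have "s \<in> ?K" using s R unfolding joining_lines_def by blast
    then have "card (?K - {s}) < card ?K" using card_Diff1_less[OF finK] by blast
    moreover have "2 * card ?S \<le> card P" using light s J_lines by blast
    ultimately show ?thesis by linarith
  next
    case False
    then have "inj_on (join x) P" using inj j by (meson inj_onI)
    moreover have "join x ` P \<subseteq> ?K" using j by blast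
    ultimately have "card P \<le> card ?K" using finK by (intro card_inj_on_le) auto
    \<comment> \<open>Here all \<open>card P\<close> joins are distinct, and two points suffice for
      \<open>card P + 2 \<le> 2 * card P\<close>.\<close>
    moreover have "2 \<le> card P"
    proof -
      obtain l where "l \<in> \<L>" using y(1) line_through incD by metis
      then obtain p q where "p \<in> P" "q \<in> P" "p \<noteq> q" using nd unfolding nondegenerate_def by blast
      then show ?thesis using fin card_mono[of P "{p, q}"] by simp
    qed
    ultimately show ?thesis by linarith
  qed
  moreover have "card (?K - {join x y}) \<le> card {l \<in> J R. (x, l) \<in> \<I> \<and> (y, l) \<notin> \<I>}"
  proof (rule card_mono)
    show "?K - {join x y} \<subseteq> {l \<in> J R. (x, l) \<in> \<I> \<and> (y, l) \<notin> \<I>}"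
      using y join_eq[of x y] by blast
  qed (use finite_J[OF R(3)] in simp)
  moreover have "card ?K - 1 \<le> card (?K - {join x y})"
    by (simp add: card_Diff_singleton_if)
  ultimately show ?thesis by linarith
qed

section \<open>A line carrying more than half of the points\<close>

text \<open>Take \<open>p\<close>, \<open>q\<close> in \<open>P\<close> off \<open>l\<close>, their
  join \<open>m\<close>, and the meet \<open>z\<close> of \<open>l\<close> and \<open>m\<close>. The
  lines from \<open>p\<close> to the points of \<open>P\<close> on \<open>l\<close> other than
  \<open>z\<close> meet the corresponding lines from \<open>q\<close> off \<open>m\<close>. If
  \<open>z\<close> is in \<open>P\<close>, its loss is made up by the points of
  \<open>M (J P)\<close> on \<open>m\<close>.\<close>

lemma card_meeting_points_heavy_line:
  assumes nd: "nondegenerate P" and fin: "finite P" and l: "l \<in> \<L>"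
    and heavy: "card P < 2 * card {p \<in> P. (p, l) \<in> \<I>}"
  shows "(card P)\<^sup>2 \<le> 4 * card (M (J P))"
proof -
  let ?S = "{p \<in> P. (p, l) \<in> \<I>}"
  define k where "k = card ?S"
  have P: "P \<subseteq> \<P>" using nd by (simp add: nondegenerate_def)
  have ext: "P \<subseteq> M (J P)" using M_J_extensive[OF nd] .
  have finN: "finite (J P)" "finite (M (J P))" using fin finite_J finite_M by blast+
  obtain p q where pq: "p \<in> P" "q \<in> P" "p \<noteq> q" "(p, l) \<notin> \<I>" "(q, l) \<notin> \<I>"
    using nd l unfolding nondegenerate_def by blast
  define m where "m = join p q"
  have m: "(p, m) \<in> \<I>" "(q, m) \<in> \<I>" "m \<in> J P"
    using pq P join_inc[of p q] join_in_J[of p P q] unfolding m_def by blast+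
  define z where "z = meet l m"
  have lm: "l \<noteq> m" using pq m by blast
  have z: "(z, l) \<in> \<I>" "(z, m) \<in> \<I>"
    using lm l m J_lines meet_inc[of l m] unfolding z_def by blast+
  let ?on = "{w \<in> M (J P). (w, m) \<in> \<I>}" and ?off = "{w \<in> M (J P). (w, m) \<notin> \<I>}"
  have pencil: "inj_on (join r) ?S"
    "\<And>s. s \<in> ?S \<Longrightarrow> join r s \<in> J P \<and> (r, join r s) \<in> \<I> \<and> (s, join r s) \<in> \<I>"
    if r: "r \<in> P" "(r, l) \<notin> \<I>" for r
  proof -
    show *: "join r s \<in> J P \<and> (r, join r s) \<in> \<I> \<and> (s, join r s) \<in> \<I>" if "s \<in> ?S" for s
      using that r P join_inc[of r s] join_in_J[of r P s] by blast
    show "inj_on (join r) ?S"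
    proof (rule inj_onI)
      fix s t assume "s \<in> ?S" "t \<in> ?S" "join r s = join r t"
      then show "s = t" using *[of s] *[of t] r line_unique[of s t l "join r s"] by force
    qed
  qed
  \<comment> \<open>If \<open>join r s\<close> contained \<open>r'\<close>, it would be
    \<open>m\<close>, and \<open>s\<close> would be \<open>z\<close>.\<close>
  have bound: "card (?S - {z}) \<le> card {a \<in> J P. (r, a) \<in> \<I> \<and> (r', a) \<notin> \<I>}"
    if r: "r \<in> P" "(r, l) \<notin> \<I>" "(r, m) \<in> \<I>" "(r', m) \<in> \<I>" "r \<noteq> r'" for r r'
  proof (rule card_inj_on_le[of "join r"])
    show "inj_on (join r) (?S - {z})" using pencil(1)[OF r(1,2)] by (rule inj_on_subset) auto
    show "join r ` (?S - {z}) \<subseteq> {a \<in> J P. (r, a) \<in> \<I> \<and> (r', a) \<notin> \<I>}"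
    proof
      fix a assume "a \<in> join r ` (?S - {z})"
      then obtain s where s: "s \<in> ?S" "s \<noteq> z" "a = join r s" by blast
      have "(r', a) \<notin> \<I>"
        using pencil(2)[OF r(1,2) s(1)] s r z lm line_unique[of r r' a m] point_unique[of l m s z] by blast
      then show "a \<in> {a \<in> J P. (r, a) \<in> \<I> \<and> (r', a) \<notin> \<I>}"
        using pencil(2)[OF r(1,2) s(1)] s by blast
    qed
  qed (use finN in simp)
  have off: "(card (?S - {z}))\<^sup>2 \<le> card ?off"
    using card_pencils_le_meeting_points[OF J_lines finN(1) pq(3) m(1,2)]
      mult_le_mono[OF bound[OF pq(1,4) m(1,2) pq(3)] bound[OF pq(2,5) m(2,1) pq(3)[symmetric]]]
    by (simp add: power2_eq_square)
  have split: "card (M (J P)) = card ?on + card ?off"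
  proof -
    have "?on \<union> ?off = M (J P)" by blast
    moreover have "card (?on \<union> ?off) = card ?on + card ?off"
      using finN by (intro card_Un_disjoint) auto
    ultimately show ?thesis by simp
  qed
  show ?thesis
  proof (cases "z \<in> P")
    case False
    then have "?S - {z} = ?S" by blast
    then have "k\<^sup>2 \<le> card (M (J P))" using off split k_def by simp
    moreover have "(card P)\<^sup>2 \<le> (2 * k)\<^sup>2" using heavy k_def by (intro power_mono) auto
    ultimately show ?thesis by (simp add: power_mult_distrib)
  next
    case True
    then have zS: "z \<in> ?S" using z by blast
    then have k1: "card (?S - {z}) = k - 1" "0 < k"
      using fin by (auto simp: k_def card_gt_0_iff)
    have kP: "k \<le> card P" unfolding k_def using fin by (intro card_mono) auto
    \<comment> \<open>Either a point \<open>r\<close> off both lines projects the \<open>k\<close>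
      points of \<open>P\<close> on \<open>l\<close> into \<open>m\<close>, or \<open>P\<close> is
      covered by \<open>l\<close> and \<open>m\<close>, whose common point \<open>z\<close> accounts
      for the \<open>+ 1\<close>.\<close>
    have "card P - k + 1 \<le> card ?on \<or> k \<le> card ?on"
    proof (cases "\<exists>r\<in>P. (r, l) \<notin> \<I> \<and> (r, m) \<notin> \<I>")
      case True
      then obtain r where r: "r \<in> P" "(r, l) \<notin> \<I>" "(r, m) \<notin> \<I>" by blast
      note pr = pencil[OF r(1,2)]
      have w: "(meet (join r s) m, join r s) \<in> \<I>" "(meet (join r s) m, m) \<in> \<I>" "join r s \<noteq> m"
        if "s \<in> ?S" for s
        using pr(2)[OF that] m r J_lines meet_inc[of "join r s" m] by blast+
      have "inj_on (\<lambda>s. meet (join r s) m) ?S"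
      proof (rule inj_onI)
        fix s t assume st: "s \<in> ?S" "t \<in> ?S" "meet (join r s) m = meet (join r t) m"
        then have "join r s = join r t"
          using pr(2)[OF st(1)] pr(2)[OF st(2)] w[OF st(1)] w[OF st(2)] r
            line_unique[of r "meet (join r t) m" "join r s" "join r t"] by metis
        then show "s = t" using pr(1) st by (meson inj_onD)
      qed
      moreover have "(\<lambda>s. meet (join r s) m) ` ?S \<subseteq> ?on"
      proof clarify
        fix s assume "s \<in> P" "(s, l) \<in> \<I>"
        then have "s \<in> ?S" by blast
        from w[OF this] pr(2)[OF this] m
        show "meet (join r s) m \<in> M (J P) \<and> (meet (join r s) m, m) \<in> \<I>" by (blast intro: MI)
      qed
      ultimately have "k \<le> card ?on" unfolding k_def using finN by (intro card_inj_on_le) auto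
      then show ?thesis ..
    next
      case False
      let ?T = "{p \<in> P. (p, m) \<in> \<I>}"
      have "P = ?S \<union> ?T" using False by blast
      moreover have "?S \<inter> ?T = {z}" using z True lm point_unique by blast
      moreover have "card (?S \<union> ?T) + card (?S \<inter> ?T) = card ?S + card ?T"
        using fin by (intro card_Un_Int[symmetric]) auto
      ultimately have "card P + 1 = k + card ?T" by (simp add: k_def)
      moreover have "card ?T \<le> card ?on" using ext finN by (intro card_mono) auto
      ultimately show ?thesis using kP by linarith
    qed
    then have on: "min k (card P - k + 1) \<le> card ?on" by auto
    have lower: "(k - 1)\<^sup>2 + min k (card P - k + 1) \<le> card (M (J P))"
      using add_mono[OF off on] unfolding split k1(1) by (simp only: add.commute)
    \<comment> \<open>With \<open>k = Suc a\<close> and \<open>card P = k + b\<close>, heaviness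
      gives \<open>b \<le> a\<close>, so the minimum in \<open>lower\<close> is
      \<open>b + 1\<close>.\<close>
    obtain b where b: "card P = k + b" using kP le_Suc_ex by blast
    obtain a where a: "k = Suc a" using k1 gr0_implies_Suc by blast
    have ba: "b \<le> a" using heavy b a unfolding k_def by linarith
    then obtain t where t: "a = b + t" using le_Suc_ex by blast
    have "t \<le> t * t" by (cases t) auto
    \<comment> \<open>Substituting \<open>a = b + t\<close> reduces the claim to
      \<open>2 * t \<le> 4 * (b * t) + 3 * (t * t) + 3\<close>, which follows from
      \<open>t \<le> t * t\<close>.\<close>
    moreover have "(card P)\<^sup>2 + (4 * (b * t) + 3 * (t * t) + 3) = 4 * (a\<^sup>2 + b + 1) + 2 * t"
      unfolding b a t by (simp add: power2_eq_square algebra_simps)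
    ultimately have "(card P)\<^sup>2 \<le> 4 * (a\<^sup>2 + b + 1)" by linarith
    also have "a\<^sup>2 + b + 1 \<le> card (M (J P))" using lower a b ba by simp
    finally show ?thesis by simp
  qed
qed

end

theorem theorem1p1:
  fixes \<P> :: "'p set" and \<L> :: "'l set" and \<I> :: "('p \<times> 'l) set" and P :: "'p set"
  assumes "projective_plane \<P> \<L> \<I>"
    and "P \<subseteq> \<P>"
    and "finite P"
  shows "real (card (gen_points \<P> \<L> \<I> P 3)) \<ge> 1 / 4 * (real (card P))\<^sup>2
    \<or> (\<exists>Q. subplane_points \<P> \<L> \<I> Q \<and>
          (gen_points \<P> \<L> \<I> P 1 = Q \<or> (\<exists>x\<in>Q. gen_points \<P> \<L> \<I> P 1 = Q - {x})))
    \<or> degenerate_subplane \<P> \<L> \<I> P"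
proof (cases "degenerate_subplane \<P> \<L> \<I> P")
  case False
  interpret plane \<P> \<L> \<I> by (rule plane.intro) (rule assms(1))
  define P1 where "P1 = M (J P)"
  define P2 where "P2 = M (J P1)"
  define P3 where "P3 = M (J P2)"
  have gen: "gen_points \<P> \<L> \<I> P 1 = P1" "gen_points \<P> \<L> \<I> P 3 = P3"
    by (simp_all add: numeral_3_eq_3 P1_def P2_def P3_def)
  have nd: "nondegenerate P" "nondegenerate P1" "nondegenerate P2"
    using nondegenerateI[OF assms(2) False] nondegenerate_M_J unfolding P1_def P2_def by blast+
  have sub: "P \<subseteq> P1" "P1 \<subseteq> P2" "P2 \<subseteq> P3"
    using nd M_J_extensive unfolding P1_def P2_def P3_def by blast+
  have fin: "finite P1" "finite P2" "finite P3"
    using assms(3) finite_J finite_M unfolding P1_def P2_def P3_def by blast+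
  have pts: "P1 \<subseteq> \<P>" "P2 \<subseteq> \<P>" using M_points unfolding P1_def P2_def by blast+
  \<comment> \<open>The cases may overlap. The bound for all lines is recorded only with two new
    points, where it makes both pencils large.\<close>
  consider (heavy) "\<exists>l\<in>\<L>. card P < 2 * card {p \<in> P. (p, l) \<in> \<I>}"
    | (zero) "P2 = P1"
    | (one) x where "x \<notin> P1" "P2 = insert x P1"
    | (two) x y where "\<And>l. l \<in> \<L> \<Longrightarrow> 2 * card {p \<in> P. (p, l) \<in> \<I>} \<le> card P"
        "x \<in> P2 - P1" "y \<in> P2 - P1" "x \<noteq> y"
  proof (cases "\<exists>x y. x \<in> P2 - P1 \<and> y \<in> P2 - P1 \<and> x \<noteq> y")
    case True
    then obtain x y where xy: "x \<in> P2 - P1" "y \<in> P2 - P1" "x \<noteq> y" by blast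
    show ?thesis
    proof (cases "\<exists>l\<in>\<L>. card P < 2 * card {p \<in> P. (p, l) \<in> \<I>}")
      case True
      then show ?thesis by (rule heavy)
    next
      case False
      then have light: "2 * card {p \<in> P. (p, l) \<in> \<I>} \<le> card P" if "l \<in> \<L>" for l
        using that not_le_imp_less by blast
      show ?thesis by (rule two[OF light xy])
    qed
  next
    case False
    then show ?thesis
    proof (cases "P2 = P1")
      case False
      then obtain x where x: "x \<in> P2 - P1" using sub(2) by blast
      then have "P2 = insert x P1" using sub(2) \<open>\<nexists>x y. x \<in> P2 - P1 \<and> y \<in> P2 - P1 \<and> x \<noteq> y\<close> by blast
      then show ?thesis using one x by blast
    qed (rule zero)
  qed
  then have "(card P)\<^sup>2 \<le> 4 * card P3 \<or> (\<exists>Q. subplane_points \<P> \<L> \<I> Q \<and>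
      (P1 = Q \<or> (\<exists>x\<in>Q. P1 = Q - {x})))"
  proof cases
    case heavy
    then have "(card P)\<^sup>2 \<le> 4 * card P1"
      using card_meeting_points_heavy_line[OF nd(1) assms(3)] unfolding P1_def by blast
    moreover have "card P1 \<le> card P3" using sub fin by (intro card_mono) auto
    ultimately show ?thesis by linarith
  next
    case zero
    then show ?thesis using subplane_pointsI[OF nd(2)] unfolding P2_def by blast
  next
    case one
    \<comment> \<open>Since \<open>P2\<close> gains no further point, it is a subplane, and
      \<open>P1\<close> is this subplane without \<open>x\<close>.\<close>
    then have "P3 = P2"
      using closed_insert[OF pts(1) fin(1) one(1)] unfolding P3_def P2_def by simp
    then have "subplane_points \<P> \<L> \<I> P2" using subplane_pointsI[OF nd(3)] unfolding P3_def by blast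
    then show ?thesis using one by blast
  next
    case two
    have sub2: "P \<subseteq> P2" using sub by blast
    have xy: "x \<in> P2" "y \<in> P2" "x \<in> \<P>" "y \<in> \<P>" "x \<notin> M (J P)" "y \<notin> M (J P)"
      using two pts unfolding P1_def by blast+
    let ?A = "{l \<in> J P2. (x, l) \<in> \<I> \<and> (y, l) \<notin> \<I>}" and ?B = "{l \<in> J P2. (y, l) \<in> \<I> \<and> (x, l) \<notin> \<I>}"
    \<comment> \<open>Used with \<open>R = P2\<close> for \<open>x\<close> against \<open>y\<close>
      and for \<open>y\<close> against \<open>x\<close>: each pencil keeps at least half of
      \<open>card P\<close> lines, and their intersections lie in \<open>P3\<close>.\<close>
    note new = card_pencil_new_point[OF nd(1) assms(3) two(1) _ _ sub2 pts(2) fin(2)]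
    have "card P \<le> 2 * card ?A" "card P \<le> 2 * card ?B"
      using new xy two(4) by auto
    then have "card P * card P \<le> (2 * card ?A) * (2 * card ?B)" by (rule mult_le_mono)
    moreover have "card ?A * card ?B \<le> card {z \<in> M (J P2). (z, join x y) \<notin> \<I>}"
      using card_pencils_le_meeting_points[OF J_lines finite_J[OF fin(2)] two(4)] join_inc xy two(4) by blast
    moreover have "\<dots> \<le> card P3"
      unfolding P3_def using fin(3) by (intro card_mono) (auto simp: P3_def)
    ultimately show ?thesis by (simp add: power2_eq_square)
  qed
  then show ?thesis
  proof
    assume "(card P)\<^sup>2 \<le> 4 * card P3"
    then have "(real (card P))\<^sup>2 \<le> 4 * real (card P3)"
      by (metis of_nat_le_iff of_nat_mult of_nat_numeral of_nat_power)
    then show ?thesis unfolding gen by simp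
  next
    assume "\<exists>Q. subplane_points \<P> \<L> \<I> Q \<and> (P1 = Q \<or> (\<exists>x\<in>Q. P1 = Q - {x}))"
    then show ?thesis unfolding gen by blast
  qed
qed simp

end
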